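(* Let $G = P_1\times P_2\times\cdots\times P_k$ be a finite nilpotent group. Then a vertex $x=(x_1,x_2,\ldots,x_k)$ (an element of $G$) does not belong to the vertex set $V(\mathcal{D}(G))$ of the difference graph $\mathcal{D}(G)$ if and only if either $x_i\in M(P_i)$ for all $i\in\{1,\dots,k\}$, or $x_i=e$ for all $i\in\{1,\dots,k\}$. Moreover, $$|V(\mathcal{D}(G))| = |G| - \big(|M(P_1)|\,|M(P_2)|\cdots|M(P_k)| + 1\big).$$
   Context: Here $P_i$ is the Sylow $p_i$-subgroup of the finite nilpotent group $G$, so that $G$ is the direct product of its Sylow subgroups. For a finite group $G$, the power graph $\mathcal{P}(G)$ is the simple graph with vertex set $G$ in which distinct $x,y$ are adjacent iff $x\in\langle y\rangle$ or $y\in\langle x\rangle$. The enhanced power graph $\mathcal{P}_E(G)$ is the simple graph with vertex set $G$ in which distinct $x,y$ are adjacent iff both belong to some common cyclic subgroup of $G$. The difference graph $\mathcal{D}(G)$ is obtained from $\mathcal{P}_E(G)$ by removing all edges of $\mathcal{P}(G)$ and then deleting all isolated vertices. A cyclic subgroup of a group $H$ is maximal cyclic if it is not properly contained in any cyclic subgroup of $H$; $M(H)$ denotes the set of all elements of $H$ that generate a maximal cyclic subgroup of $H$. The identity element is denoted by $e$.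
   Formalization: The formal theorem assumes k ≥ 2, i.e. G is neither trivial nor a p-group; for k = 1 the claim fails (e.g. G = Z_4, where D(G) has no vertices but the formula gives 1), holding only when G has exponent p and D(G) is empty; for k = 0 the formula gives −1. *)

theory Defs
  imports "HOL-Algebra.Algebra" "HOL-Computational_Algebra.Primes"
begin

text \<open>A simple graph is a vertex set together with a set of two-element subsets of it.\<close>

type_synonym 'a sgraph = "'a set \<times> 'a set set"

definition verts :: "'a sgraph \<Rightarrow> 'a set"
  where "verts \<Gamma> = fst \<Gamma>"

definition edges :: "'a sgraph \<Rightarrow> 'a set set"
  where "edges \<Gamma> = snd \<Gamma>"

definition isolated_vertex :: "'a sgraph \<Rightarrow> 'a \<Rightarrow> bool"
  where "isolated_vertex \<Gamma> v \<longleftrightarrow> v \<in> verts \<Gamma> \<and> (\<forall>w. {v, w} \<notin> edges \<Gamma>)"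

definition cyclic_subgroup :: "('a, 'b) monoid_scheme \<Rightarrow> 'a set \<Rightarrow> bool"
  where "cyclic_subgroup G C \<longleftrightarrow> subgroup C G \<and> cyclic_group (G\<lparr>carrier := C\<rparr>)"

definition maximal_cyclic_subgroup :: "('a, 'b) monoid_scheme \<Rightarrow> 'a set \<Rightarrow> bool"
  where "maximal_cyclic_subgroup G C \<longleftrightarrow>
    cyclic_subgroup G C \<and> \<not> (\<exists>D. cyclic_subgroup G D \<and> C \<subset> D)"

definition max_cyclic_generators :: "('a, 'b) monoid_scheme \<Rightarrow> 'a set"
  where "max_cyclic_generators H =
    {x \<in> carrier H. maximal_cyclic_subgroup H (generate H {x})}"

definition power_graph :: "('a, 'b) monoid_scheme \<Rightarrow> 'a sgraph"
  where "power_graph G = (carrier G,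
    {{x, y} | x y. x \<in> carrier G \<and> y \<in> carrier G \<and> x \<noteq> y \<and>
                   (x \<in> generate G {y} \<or> y \<in> generate G {x})})"

definition enhanced_power_graph :: "('a, 'b) monoid_scheme \<Rightarrow> 'a sgraph"
  where "enhanced_power_graph G = (carrier G,
    {{x, y} | x y. x \<in> carrier G \<and> y \<in> carrier G \<and> x \<noteq> y \<and>
                   (\<exists>C. cyclic_subgroup G C \<and> x \<in> C \<and> y \<in> C)})"

definition remove_edges :: "'a sgraph \<Rightarrow> 'a set set \<Rightarrow> 'a sgraph"
  where "remove_edges \<Gamma> F = (verts \<Gamma>, edges \<Gamma> - F)"

definition delete_isolated :: "'a sgraph \<Rightarrow> 'a sgraph"
  where "delete_isolated \<Gamma> = ({v \<in> verts \<Gamma>. \<not> isolated_vertex \<Gamma> v}, edges \<Gamma>)"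

definition difference_graph :: "('a, 'b) monoid_scheme \<Rightarrow> 'a sgraph"
  where "difference_graph G =
    delete_isolated (remove_edges (enhanced_power_graph G) (edges (power_graph G)))"

text \<open>Nilpotency is expressed by the upper central series: \<open>Z\<^sub>0\<close> is trivial, and \<open>Z\<^sub>n\<^sub>+\<^sub>1\<close>
  consists of the elements that are central modulo \<open>Z\<^sub>n\<close>, that is, whose commutators with
  all group elements lie in \<open>Z\<^sub>n\<close>.\<close>

primrec upper_central :: "('a, 'b) monoid_scheme \<Rightarrow> nat \<Rightarrow> 'a set"
  where
    "upper_central G 0 = {\<one>\<^bsub>G\<^esub>}"
  | "upper_central G (Suc n) = {x \<in> carrier G. \<forall>y \<in> carrier G.
       x \<otimes>\<^bsub>G\<^esub> y \<otimes>\<^bsub>G\<^esub> inv\<^bsub>G\<^esub> x \<otimes>\<^bsub>G\<^esub> inv\<^bsub>G\<^esub> y \<in> upper_central G n}"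

definition nilpotent_group :: "('a, 'b) monoid_scheme \<Rightarrow> bool"
  where "nilpotent_group G \<longleftrightarrow> group G \<and> (\<exists>n. upper_central G n = carrier G)"

definition sylow_subgroup :: "('a, 'b) monoid_scheme \<Rightarrow> nat \<Rightarrow> 'a set \<Rightarrow> bool"
  where "sylow_subgroup G p P \<longleftrightarrow> subgroup P G \<and> card P = p ^ multiplicity p (order G)"

text \<open>The element \<open>x\<^sub>1 \<otimes> \<dots> \<otimes> x\<^sub>k\<close>, which represents the tuple \<open>(x\<^sub>1, \<dots>, x\<^sub>k)\<close> when \<open>G\<close> is
  regarded as the internal direct product of subgroups \<open>P\<^sub>1, \<dots>, P\<^sub>k\<close> with \<open>x\<^sub>i \<in> P\<^sub>i\<close>.  A list
  product is used because \<open>finprod\<close> is only meaningful in commutative monoids.\<close>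

definition tuple_elt :: "('a, 'b) monoid_scheme \<Rightarrow> nat \<Rightarrow> (nat \<Rightarrow> 'a) \<Rightarrow> 'a"
  where "tuple_elt G k xs = foldr (\<otimes>\<^bsub>G\<^esub>) (map xs [1..<Suc k]) \<one>\<^bsub>G\<^esub>"

end

theory Submission
  imports Defs "HOL-Number_Theory.Cong"
begin

text \<open>If \<open>a\<close> and \<open>b\<close> have coprime orders and their commutator \<open>c\<close> is central modulo a term \<open>Z\<close> of the
  upper central series, then modulo \<open>Z\<close> the order of \<open>c\<close> divides both orders, so \<open>c \<in> Z\<close>; descending
  the series yields \<open>c = \<one>\<close>. Hence distinct Sylow subgroups of a nilpotent group commute elementwise,
  and by counting \<open>G\<close> is their direct product. As the factors have coprime orders, \<open>y \<in> \<langle>x\<rangle>\<close> can be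
  tested componentwise. So \<open>x\<close> is isolated if all its components generate maximal cyclic subgroups;
  otherwise, for \<open>x \<noteq> \<one>\<close>, some component can be enlarged to exhibit an edge at \<open>x\<close>.\<close>

section \<open>Cyclic subgroups\<close>

context group
begin

lemma generate_singleton_subset_iff:
  assumes "x \<in> carrier G" "y \<in> carrier G"
  shows "generate G {x} \<subseteq> generate G {y} \<longleftrightarrow> x \<in> generate G {y}"
  using assms generate_subgroup_incl[OF _ generate_is_subgroup, of "{x}" "{y}"]
    generate.incl[of x "{x}" G] by auto

text \<open>\<open>cyclic_group\<close> speaks of generation inside the restricted group
  \<open>G\<lparr>carrier := C\<rparr>\<close>. Since generation gives the same set there and in
  \<open>G\<close>, all later arguments can use \<open>generate G\<close> alone.\<close>

lemma cyclic_subgroup_iff: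
  "cyclic_subgroup G C \<longleftrightarrow> (\<exists>x\<in>carrier G. C = generate G {x})"
proof
  assume "cyclic_subgroup G C"
  then obtain x where C: "subgroup C G" and x: "x \<in> C"
    and eq: "subgroup_generated (G\<lparr>carrier := C\<rparr>) {x} = G\<lparr>carrier := C\<rparr>"
    by (auto simp: cyclic_subgroup_def cyclic_group_def)
  have "C = generate (G\<lparr>carrier := C\<rparr>) {x}"
    using arg_cong[OF eq, of carrier] x by (simp add: carrier_subgroup_generated)
  also have "\<dots> = generate G {x}"
    using x C by (intro generate_consistent) auto
  finally show "\<exists>x\<in>carrier G. C = generate G {x}"
    using x subgroup.mem_carrier[OF C] by blast
next
  assume "\<exists>x\<in>carrier G. C = generate G {x}"
  then obtain x where x: "x \<in> carrier G" and C: "C = generate G {x}" by blast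
  have sub: "subgroup C G" and xC: "x \<in> C"
    using x by (auto simp: C generate_is_subgroup generate.incl)
  have "subgroup_generated (G\<lparr>carrier := C\<rparr>) {x} = G\<lparr>carrier := C\<rparr>"
    using generate_consistent[of "{x}" C] sub xC C by (simp add: subgroup_generated_def)
  then show "cyclic_subgroup G C"
    using sub xC by (auto simp: cyclic_subgroup_def cyclic_group_def)
qed

text \<open>Inclusion between cyclic subgroups amounts to membership of a generator, so maximality
  becomes a condition on elements, which can later be tested componentwise.\<close>

lemma mem_max_cyclic_generators_iff:
  "x \<in> max_cyclic_generators G \<longleftrightarrow>
     x \<in> carrier G \<and> (\<forall>z\<in>carrier G. x \<in> generate G {z} \<longrightarrow> z \<in> generate G {x})"
proof (cases "x \<in> carrier G")
  case True
  then have "x \<in> max_cyclic_generators G \<longleftrightarrow>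
      (\<forall>z\<in>carrier G. generate G {x} \<subseteq> generate G {z} \<longrightarrow> generate G {z} \<subseteq> generate G {x})"
    unfolding max_cyclic_generators_def maximal_cyclic_subgroup_def cyclic_subgroup_iff by blast
  then show ?thesis
    using True by (simp add: generate_singleton_subset_iff)
qed (simp add: max_cyclic_generators_def)

text \<open>Generation in \<open>H\<close> agrees with generation in \<open>G\<close>, which makes
  maximality inside a factor comparable with statements about \<open>G\<close>.\<close>

lemma mem_max_cyclic_generators_subgroup_iff:
  assumes "subgroup H G"
  shows "x \<in> max_cyclic_generators (G\<lparr>carrier := H\<rparr>) \<longleftrightarrow>
     x \<in> H \<and> (\<forall>z\<in>H. x \<in> generate G {z} \<longrightarrow> z \<in> generate G {x})"
proof -
  interpret H: group "G\<lparr>carrier := H\<rparr>"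
    using assms by (rule subgroup_imp_group)
  show ?thesis
    using assms by (auto simp: H.mem_max_cyclic_generators_iff generate_consistent)
qed

text \<open>Here \<open>y\<close> is a neighbour of \<open>x\<close> and \<open>z\<close> generates
  the cyclic subgroup joining them. Distinctness is implicit, because \<open>x\<close> lies in its
  own span.\<close>

lemma mem_verts_difference_graph_iff:
  "x \<in> verts (difference_graph G) \<longleftrightarrow>
     x \<in> carrier G \<and> (\<exists>y\<in>carrier G. \<exists>z\<in>carrier G. x \<in> generate G {z} \<and> y \<in> generate G {z} \<and>
       x \<notin> generate G {y} \<and> y \<notin> generate G {x})" (is "?L \<longleftrightarrow> ?R")
proof
  assume ?L
  then show ?R
    by (fastforce simp: difference_graph_def delete_isolated_def remove_edges_def verts_def edges_def
        isolated_vertex_def enhanced_power_graph_def power_graph_def cyclic_subgroup_iff doubleton_eq_iff)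
next
  assume ?R
  then obtain y z where *: "x \<in> carrier G" "y \<in> carrier G" "z \<in> carrier G"
    "x \<in> generate G {z}" "y \<in> generate G {z}" "x \<notin> generate G {y}" "y \<notin> generate G {x}"
    by blast
  then have "x \<noteq> y" by (auto intro: generate.incl)
  with * have "{x, y} \<in> edges (enhanced_power_graph G)"
    by (auto simp: edges_def enhanced_power_graph_def cyclic_subgroup_iff)
  moreover have "{x, y} \<notin> edges (power_graph G)"
    using * by (auto simp: edges_def power_graph_def doubleton_eq_iff)
  ultimately show ?L
    using * by (auto simp: difference_graph_def delete_isolated_def remove_edges_def verts_def edges_def
        isolated_vertex_def enhanced_power_graph_def)
qed

lemma mem_generate_iff_nat_pow:
  assumes "finite (carrier G)" "y \<in> carrier G"
  shows "x \<in> generate G {y} \<longleftrightarrow> (\<exists>n::nat. x = y [^] n)"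
  using assms by (auto simp: generate_pow_on_finite_carrier)

end

section \<open>Coprime orders in nilpotent groups\<close>

context group
begin

lemma commute_inv:
  assumes "a \<in> carrier G" "b \<in> carrier G" "a \<otimes> b = b \<otimes> a"
  shows "inv a \<otimes> b = b \<otimes> inv a"
  using assms by (metis inv_closed inv_solve_left inv_solve_right m_assoc m_closed)

lemma commute_mult:
  assumes "a \<in> carrier G" "b \<in> carrier G" "c \<in> carrier G" "a \<otimes> c = c \<otimes> a" "b \<otimes> c = c \<otimes> b"
  shows "(a \<otimes> b) \<otimes> c = c \<otimes> (a \<otimes> b)"
  using assms by (metis m_assoc)

text \<open>This form of the commutator, a factor paid for swapping \<open>a\<close> and
  \<open>b\<close>, passes to quotients through multiplicativity alone.\<close>

lemma mult_eq_commutator_mult: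
  assumes "a \<in> carrier G" "b \<in> carrier G"
  shows "a \<otimes> b = (a \<otimes> b \<otimes> inv a \<otimes> inv b) \<otimes> (b \<otimes> a)"
proof -
  have "(a \<otimes> b \<otimes> inv a \<otimes> inv b) \<otimes> (b \<otimes> a) = a \<otimes> b \<otimes> (inv a \<otimes> ((inv b \<otimes> b) \<otimes> a))"
    using assms by (simp only: m_assoc m_closed inv_closed)
  then show ?thesis using assms by simp
qed

lemma commutator_eq_one_iff:
  assumes "a \<in> carrier G" "b \<in> carrier G"
  shows "a \<otimes> b \<otimes> inv a \<otimes> inv b = \<one> \<longleftrightarrow> a \<otimes> b = b \<otimes> a"
proof -
  have "a \<otimes> b = b \<otimes> a \<longleftrightarrow> (a \<otimes> b \<otimes> inv a \<otimes> inv b) \<otimes> (b \<otimes> a) = \<one> \<otimes> (b \<otimes> a)"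
    using assms mult_eq_commutator_mult[OF assms] by simp
  also have "\<dots> \<longleftrightarrow> a \<otimes> b \<otimes> inv a \<otimes> inv b = \<one>"
    using assms by (subst r_cancel) auto
  finally show ?thesis by simp
qed

text \<open>Each of the \<open>n\<close> factors \<open>a\<close> that passes \<open>b\<close>
  leaves one \<open>c\<close>; as \<open>c\<close> commutes with \<open>a\<close>, these collect in
  front.\<close>

lemma pow_twisted_commute:
  fixes n :: nat
  assumes a: "a \<in> carrier G" and b: "b \<in> carrier G" and c: "c \<in> carrier G"
    and ab: "a \<otimes> b = c \<otimes> (b \<otimes> a)" and ca: "c \<otimes> a = a \<otimes> c"
  shows "a [^] n \<otimes> b = c [^] n \<otimes> (b \<otimes> a [^] n)"
proof (induction n)
  case 0
  then show ?case using b by simp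
next
  case (Suc n)
  have "a [^] Suc n \<otimes> b = a [^] n \<otimes> (a \<otimes> b)" using a b by (simp add: m_assoc)
  also have "\<dots> = (a [^] n \<otimes> c) \<otimes> (b \<otimes> a)" using a b c by (simp add: ab m_assoc)
  also have "a [^] n \<otimes> c = c \<otimes> a [^] n" using group_commutes_pow[OF ca[symmetric] a c] .
  also have "c \<otimes> a [^] n \<otimes> (b \<otimes> a) = c \<otimes> (a [^] n \<otimes> b) \<otimes> a"
    using a b c by (simp add: m_assoc)
  also have "\<dots> = (c \<otimes> c [^] n) \<otimes> (b \<otimes> (a [^] n \<otimes> a))"
    unfolding Suc using a b c by (simp add: m_assoc)
  also have "c \<otimes> c [^] n = c [^] Suc n" using nat_pow_Suc2[OF c] by simp
  finally show ?case by simp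
qed

lemma twisted_commute_pow_eq_one:
  fixes m :: nat
  assumes "a \<in> carrier G" and "b \<in> carrier G" and "c \<in> carrier G"
    and "a \<otimes> b = c \<otimes> (b \<otimes> a)" and "c \<otimes> a = a \<otimes> c" and "a [^] m = \<one>"
  shows "c [^] m = \<one>"
  using pow_twisted_commute[OF assms(1-5), of m] assms by simp

lemma commute_if_coprime_pow:
  fixes m n :: nat
  assumes a: "a \<in> carrier G" and b: "b \<in> carrier G" and c: "c \<in> carrier G"
    and ab: "a \<otimes> b = c \<otimes> (b \<otimes> a)" and ca: "c \<otimes> a = a \<otimes> c" and cb: "c \<otimes> b = b \<otimes> c"
    and m: "a [^] m = \<one>" and n: "b [^] n = \<one>" and "coprime m n"
  shows "c = \<one>"
proof -
  have "c [^] m = \<one>"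
    using twisted_commute_pow_eq_one[OF a b c ab ca m] .
  \<comment> \<open>Exchanging \<open>a\<close> and \<open>b\<close> inverts the commutator, so the
    same lemma bounds the order of \<open>c\<close> by the exponent of \<open>b\<close>.\<close>
  moreover have "inv c [^] n = \<one>"
  proof (rule twisted_commute_pow_eq_one[OF b a _ _ _ n])
    show "b \<otimes> a = inv c \<otimes> (a \<otimes> b)"
      using a b c by (simp add: ab inv_solve_left)
    show "inv c \<otimes> b = b \<otimes> inv c"
      using c b cb by (rule commute_inv)
  qed (use c in auto)
  then have "c [^] n = \<one>"
    using c by (metis nat_pow_inv inv_eq_1_iff nat_pow_closed)
  ultimately have "ord c dvd 1"
    using c \<open>coprime m n\<close> by (metis coprime_common_divisor pow_eq_id)
  then show ?thesis
    using c by (metis pow_eq_id nat_pow_eone)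
qed

end

section \<open>Commutation modulo a normal subgroup\<close>

context normal
begin

lemma rcos_group_hom: "group_hom G (G Mod H) (\<lambda>x. H #> x)"
  by (simp add: group_hom_def group_hom_axioms_def factorgroup_is_group r_coset_hom_Mod is_group)

lemma rcos_eq_one_iff: "x \<in> carrier G \<Longrightarrow> H #> x = \<one>\<^bsub>G Mod H\<^esub> \<longleftrightarrow> x \<in> H"
  using coset_join1[OF _ _ subgroup_axioms, of x] coset_join2[OF _ subgroup_axioms, of x]
  by (auto simp only: one_FactGroup)

lemma commutator_mem_iff:
  assumes "x \<in> carrier G" "y \<in> carrier G"
  shows "x \<otimes> y \<otimes> inv x \<otimes> inv y \<in> H \<longleftrightarrow>
    (H #> x) \<otimes>\<^bsub>G Mod H\<^esub> (H #> y) = (H #> y) \<otimes>\<^bsub>G Mod H\<^esub> (H #> x)"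
proof -
  interpret h: group_hom G "G Mod H" "\<lambda>x. H #> x" by (rule rcos_group_hom)
  show ?thesis
    using assms h.H.commutator_eq_one_iff[of "H #> x" "H #> y"] rcos_eq_one_iff[of "x \<otimes> y \<otimes> inv x \<otimes> inv y"]
    by (simp only: h.hom_mult h.hom_inv h.hom_closed m_closed inv_closed)
qed

text \<open>The set is the preimage of the centre of \<open>G Mod H\<close>; with a term of the
  upper central series for \<open>H\<close> it is the next term.\<close>

lemma normal_central_mod:
  "{x \<in> carrier G. \<forall>y \<in> carrier G. x \<otimes> y \<otimes> inv x \<otimes> inv y \<in> H} \<lhd> G"
proof -
  interpret h: group_hom G "G Mod H" "\<lambda>x. H #> x" by (rule rcos_group_hom)
  let ?K = "G Mod H"
  define Z where "Z = {x \<in> carrier G. \<forall>y \<in> carrier G.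
    (H #> x) \<otimes>\<^bsub>?K\<^esub> (H #> y) = (H #> y) \<otimes>\<^bsub>?K\<^esub> (H #> x)}"
  have Z: "{x \<in> carrier G. \<forall>y \<in> carrier G. x \<otimes> y \<otimes> inv x \<otimes> inv y \<in> H} = Z"
    by (auto simp only: Z_def commutator_mem_iff)
  have "subgroup Z G"
  proof (rule subgroupI)
    show "Z \<subseteq> carrier G" by (auto simp: Z_def)
    have "\<one> \<in> Z"
      by (simp add: Z_def del: mult_FactGroup one_FactGroup)
    then show "Z \<noteq> {}" by blast
  next
    fix a assume a: "a \<in> Z"
    have "inv\<^bsub>?K\<^esub> (H #> a) \<otimes>\<^bsub>?K\<^esub> (H #> y) = (H #> y) \<otimes>\<^bsub>?K\<^esub> inv\<^bsub>?K\<^esub> (H #> a)"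
      if y: "y \<in> carrier G" for y
      using a y by (intro h.H.commute_inv) (auto simp: Z_def simp del: mult_FactGroup)
    then show "inv a \<in> Z"
      using a by (simp add: Z_def del: mult_FactGroup one_FactGroup)
  next
    fix a b assume a: "a \<in> Z" and b: "b \<in> Z"
    have "((H #> a) \<otimes>\<^bsub>?K\<^esub> (H #> b)) \<otimes>\<^bsub>?K\<^esub> (H #> y) =
        (H #> y) \<otimes>\<^bsub>?K\<^esub> ((H #> a) \<otimes>\<^bsub>?K\<^esub> (H #> b))"
      if y: "y \<in> carrier G" for y
    proof (rule h.H.commute_mult)
      show "(H #> a) \<otimes>\<^bsub>?K\<^esub> (H #> y) = (H #> y) \<otimes>\<^bsub>?K\<^esub> (H #> a)"
        using a y unfolding Z_def by blast
      show "(H #> b) \<otimes>\<^bsub>?K\<^esub> (H #> y) = (H #> y) \<otimes>\<^bsub>?K\<^esub> (H #> b)"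
        using b y unfolding Z_def by blast
    qed (use a b y in \<open>auto simp only: Z_def mem_Collect_eq h.hom_closed\<close>)
    moreover have "a \<in> carrier G" "b \<in> carrier G"
      using a b by (simp_all add: Z_def)
    ultimately show "a \<otimes> b \<in> Z"
      by (simp add: Z_def del: mult_FactGroup one_FactGroup)
  qed
  moreover have "x \<otimes> a \<otimes> inv x \<in> Z" if x: "x \<in> carrier G" and a: "a \<in> Z" for x a
  proof -
    \<comment> \<open>The cosets of \<open>x\<close> and \<open>a\<close> commute, so conjugating
      \<open>a\<close> by \<open>x\<close> stays in the coset of \<open>a\<close>, and membership in
      \<open>Z\<close> depends only on the coset.\<close>
    have "(H #> x \<otimes> a) = (H #> a \<otimes> x)"
      using x a by (simp add: Z_def del: mult_FactGroup)
    then have "H #> (x \<otimes> a \<otimes> inv x) = H #> (a \<otimes> x \<otimes> inv x)"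
      using x a by (simp add: Z_def del: mult_FactGroup)
    also have "\<dots> = H #> a"
      using x a by (simp add: Z_def m_assoc del: mult_FactGroup)
    finally show ?thesis
      using x a by (simp add: Z_def del: mult_FactGroup)
  qed
  ultimately show ?thesis
    unfolding Z by (simp add: normal_inv_iff)
qed

end

section \<open>Descent along the upper central series\<close>

context group
begin

lemma normal_upper_central: "upper_central G n \<lhd> G"
proof (induction n)
  case 0
  then show ?case by (simp add: one_is_normal)
next
  case (Suc n)
  then show ?case using normal.normal_central_mod by simp
qed

lemma nilpotent_coprime_commute:
  fixes m n :: nat
  assumes "nilpotent_group G" and a: "a \<in> carrier G" and b: "b \<in> carrier G"
    and m: "a [^] m = \<one>" and n: "b [^] n = \<one>" and coprime: "coprime m n"
  shows "a \<otimes> b = b \<otimes> a"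
proof -
  define c where "c = a \<otimes> b \<otimes> inv a \<otimes> inv b"
  have c: "c \<in> carrier G" using a b by (simp add: c_def)
  \<comment> \<open>With \<open>c\<close> fixed, the induction step only has to push
    \<open>c\<close> from one term of the series down to the preceding one.\<close>
  have "c \<in> upper_central G j \<Longrightarrow> c = \<one>" for j
  proof (induction j)
    case 0
    then show ?case by simp
  next
    case (Suc j)
    let ?Z = "upper_central G j"
    interpret Z: normal ?Z G by (rule normal_upper_central)
    interpret h: group_hom G "G Mod ?Z" "\<lambda>x. ?Z #> x" by (rule Z.rcos_group_hom)
    \<comment> \<open>Membership in the next term says that \<open>c\<close> is central modulo
      \<open>?Z\<close>; this gives both commutation premises of
      \<open>commute_if_coprime_pow\<close> in the quotient.\<close>
    have comm: "(?Z #> c) \<otimes>\<^bsub>G Mod ?Z\<^esub> (?Z #> x) = (?Z #> x) \<otimes>\<^bsub>G Mod ?Z\<^esub> (?Z #> c)"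
      if "x \<in> carrier G" for x
      using Suc.prems c that Z.commutator_mem_iff[of c x] by simp
    have "?Z #> c = \<one>\<^bsub>G Mod ?Z\<^esub>"
    proof (rule h.H.commute_if_coprime_pow[OF _ _ _ _ comm comm _ _ coprime])
      have "?Z #> (a \<otimes> b) = ?Z #> (c \<otimes> (b \<otimes> a))"
        using mult_eq_commutator_mult[OF a b] by (simp add: c_def)
      then show "(?Z #> a) \<otimes>\<^bsub>G Mod ?Z\<^esub> (?Z #> b) =
          (?Z #> c) \<otimes>\<^bsub>G Mod ?Z\<^esub> ((?Z #> b) \<otimes>\<^bsub>G Mod ?Z\<^esub> (?Z #> a))"
        using a b c by (simp del: mult_FactGroup)
      show "(?Z #> a) [^]\<^bsub>G Mod ?Z\<^esub> m = \<one>\<^bsub>G Mod ?Z\<^esub>"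
        using a m by (metis h.hom_nat_pow h.hom_one)
      show "(?Z #> b) [^]\<^bsub>G Mod ?Z\<^esub> n = \<one>\<^bsub>G Mod ?Z\<^esub>"
        using b n by (metis h.hom_nat_pow h.hom_one)
    qed (use a b c h.hom_closed in auto)
    then show ?case
      using Suc.IH Z.rcos_eq_one_iff c by blast
  qed
  \<comment> \<open>Nilpotency starts the descent: some term is all of \<open>G\<close> and so
    contains \<open>c\<close>.\<close>
  moreover obtain j where "upper_central G j = carrier G"
    using assms(1) by (auto simp: nilpotent_group_def)
  ultimately show ?thesis
    using c commutator_eq_one_iff[OF a b] by (metis c_def)
qed

lemma subgroup_pow_card_eq_one:
  assumes "subgroup H G" "a \<in> H"
  shows "a [^] card H = \<one>"
proof -
  interpret H: group "G\<lparr>carrier := H\<rparr>"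
    using assms(1) by (rule subgroup_imp_group)
  show ?thesis
    using H.pow_order_eq_1[of a] assms(2) by (simp add: order_def nat_pow_consistent[symmetric])
qed

end

section \<open>Products of commuting families\<close>

context monoid
begin

text \<open>An arbitrary index list in place of the interval in \<open>tuple_elt\<close> allows
  induction on the list.\<close>

abbreviation list_mult :: "('i \<Rightarrow> 'a) \<Rightarrow> 'i list \<Rightarrow> 'a"
  where "list_mult f L \<equiv> foldr (\<otimes>) (map f L) \<one>"

lemma list_mult_closed: "f ` set L \<subseteq> carrier G \<Longrightarrow> list_mult f L \<in> carrier G"
  by (induction L) auto

lemma list_mult_commute:
  assumes "a \<in> carrier G" "f ` set L \<subseteq> carrier G" "\<And>i. i \<in> set L \<Longrightarrow> a \<otimes> f i = f i \<otimes> a"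
  shows "a \<otimes> list_mult f L = list_mult f L \<otimes> a"
  using assms(2,3)
proof (induction L)
  case Nil
  then show ?case using assms(1) by simp
next
  case (Cons i L)
  have *: "list_mult f L \<in> carrier G" "f i \<in> carrier G" "a \<otimes> f i = f i \<otimes> a"
    "a \<otimes> list_mult f L = list_mult f L \<otimes> a"
    using Cons by (auto intro!: list_mult_closed)
  then show ?case
    using assms(1) by simp (metis m_assoc)
qed

text \<open>The interleaved factors are sorted by moving each \<open>g i\<close> to the right past
  the later \<open>f j\<close>. With powers of one family it drives the induction in
  \<open>list_mult_pow\<close>.\<close>

lemma list_mult_mult:
  assumes "distinct L" "f ` set L \<subseteq> carrier G" "g ` set L \<subseteq> carrier G"
    "\<And>i j. i \<in> set L \<Longrightarrow> j \<in> set L \<Longrightarrow> i \<noteq> j \<Longrightarrow> g i \<otimes> f j = f j \<otimes> g i"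
  shows "list_mult (\<lambda>i. f i \<otimes> g i) L = list_mult f L \<otimes> list_mult g L"
  using assms
proof (induction L)
  case Nil
  then show ?case by simp
next
  case (Cons i L)
  have closed: "list_mult f L \<in> carrier G" "list_mult g L \<in> carrier G" "f i \<in> carrier G" "g i \<in> carrier G"
    using Cons.prems by (auto intro!: list_mult_closed)
  have comm: "g i \<otimes> list_mult f L = list_mult f L \<otimes> g i"
    using Cons.prems by (intro list_mult_commute) auto
  have IH: "list_mult (\<lambda>i. f i \<otimes> g i) L = list_mult f L \<otimes> list_mult g L"
    using Cons.prems by (intro Cons.IH) auto
  have "list_mult (\<lambda>i. f i \<otimes> g i) (i # L) = f i \<otimes> (g i \<otimes> list_mult f L) \<otimes> list_mult g L"
    using closed by (simp add: IH m_assoc)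
  also have "\<dots> = list_mult f (i # L) \<otimes> list_mult g (i # L)"
    unfolding comm using closed by (simp add: m_assoc)
  finally show ?case .
qed

lemma list_mult_pow:
  fixes n :: nat
  assumes "distinct L" "f ` set L \<subseteq> carrier G"
    "\<And>i j. i \<in> set L \<Longrightarrow> j \<in> set L \<Longrightarrow> i \<noteq> j \<Longrightarrow> f i \<otimes> f j = f j \<otimes> f i"
  shows "list_mult (\<lambda>i. f i [^] n) L = list_mult f L [^] n"
proof (induction n)
  case 0
  then show ?case by (induction L) auto
next
  case (Suc n)
  have "list_mult (\<lambda>i. f i [^] n \<otimes> f i) L = list_mult (\<lambda>i. f i [^] n) L \<otimes> list_mult f L"
    using assms by (intro list_mult_mult) (auto intro!: group_commutes_pow[symmetric])
  then show ?case by (simp add: Suc)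
qed

lemma list_mult_single:
  assumes "distinct L" "i \<in> set L" "f i \<in> carrier G" "\<And>j. j \<in> set L \<Longrightarrow> j \<noteq> i \<Longrightarrow> f j = \<one>"
  shows "list_mult f L = f i"
  using assms
proof (induction L)
  case Nil
  then show ?case by simp
next
  case (Cons j L)
  have *: "list_mult f L = \<one>" if "\<forall>j\<in>set L. f j = \<one>"
    using that by (induction L) auto
  show ?case
  proof (cases "j = i")
    case True
    then have "\<forall>j\<in>set L. f j = \<one>" using Cons.prems by auto
    then show ?thesis using * True Cons.prems by simp
  next
    case False
    then show ?thesis using Cons by auto
  qed
qed

end

context group
begin

lemma subgroup_list_mult_closed:
  assumes "subgroup H G" "f ` set L \<subseteq> H"
  shows "list_mult f L \<in> H"
  using assms(2) by (induction L) (auto simp: subgroup.one_closed[OF assms(1)] subgroup.m_closed[OF assms(1)])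

end

section \<open>Direct products of subgroups of coprime orders\<close>

text \<open>These are the facts about Sylow subgroups from which the direct decomposition follows.
  \<open>order_eq\<close> replaces an argument that the factors generate \<open>G\<close>:
  injectivity and counting give surjectivity.\<close>

locale coprime_product = group G for G (structure) +
  fixes k :: nat and P :: "nat \<Rightarrow> 'a set"
  assumes finite_carrier: "finite (carrier G)"
    and subgroup_factor: "i \<in> {1..k} \<Longrightarrow> subgroup (P i) G"
    and coprime_card: "i \<in> {1..k} \<Longrightarrow> j \<in> {1..k} \<Longrightarrow> i \<noteq> j \<Longrightarrow> coprime (card (P i)) (card (P j))"
    and factors_commute: "i \<in> {1..k} \<Longrightarrow> j \<in> {1..k} \<Longrightarrow> i \<noteq> j \<Longrightarrow> a \<in> P i \<Longrightarrow> b \<in> P j \<Longrightarrow>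
      a \<otimes> b = b \<otimes> a"
    and order_eq: "order G = (\<Prod>i\<in>{1..k}. card (P i))"
begin

text \<open>Values outside the index range are arbitrary, as for the tuples of the theorem; counting
  uses the extensional version \<open>Pi\<^sub>E\<close>.\<close>

abbreviation "tuples \<equiv> Pi {1..k} P"

lemma tuple_elt_eq: "tuple_elt G k xs = list_mult xs [1..<Suc k]"
  by (simp only: tuple_elt_def)

lemma tuple_component: "xs \<in> tuples \<Longrightarrow> i \<in> {1..k} \<Longrightarrow> xs i \<in> carrier G"
  using subgroup.mem_carrier[OF subgroup_factor] by blast

lemma tuple_elt_closed:
  assumes "xs \<in> tuples"
  shows "tuple_elt G k xs \<in> carrier G"
  unfolding tuple_elt_eq using tuple_component[OF assms] by (intro list_mult_closed) auto

lemma tuple_elt_cong: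
  assumes "\<And>i. i \<in> {1..k} \<Longrightarrow> xs i = ys i"
  shows "tuple_elt G k xs = tuple_elt G k ys"
proof -
  have "map xs [1..<Suc k] = map ys [1..<Suc k]"
    using assms by (intro map_cong) auto
  then show ?thesis by (simp only: tuple_elt_def)
qed

lemma tuple_elt_pow:
  fixes n :: nat
  assumes "xs \<in> tuples"
  shows "tuple_elt G k xs [^] n = tuple_elt G k (\<lambda>i. xs i [^] n)"
proof -
  have comm: "xs i \<otimes> xs j = xs j \<otimes> xs i" if "i \<in> {1..k}" "j \<in> {1..k}" "i \<noteq> j" for i j
    using that assms by (intro factors_commute[of i j]) auto
  show ?thesis
    unfolding tuple_elt_eq using tuple_component[OF assms] comm
    by (intro list_mult_pow[symmetric]) (auto simp: less_Suc_eq_le)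
qed

text \<open>By the Chinese remainder theorem, projecting to a factor is raising to a suitable power.\<close>

lemma projection_is_power:
  assumes i: "i \<in> {1..k}"
  obtains N :: nat where "\<And>xs. xs \<in> tuples \<Longrightarrow> tuple_elt G k xs [^] N = xs i"
proof -
  let ?m = "\<Prod>j\<in>{1..k} - {i}. card (P j)"
  \<comment> \<open>The exponent \<open>N\<close> is to be 1 modulo the order of factor
    \<open>i\<close> and 0 modulo the orders of all others: it fixes entry \<open>i\<close> and
    kills the rest.\<close>
  have "coprime (card (P i)) ?m"
    using i by (intro prod_coprime_right coprime_card) auto
  then obtain N where N1: "[N = 1] (mod card (P i))" and N0: "[N = 0] (mod ?m)"
    using binary_chinese_remainder_nat by blast
  have "tuple_elt G k xs [^] N = xs i" if xs: "xs \<in> tuples" for xs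
  proof -
    have one: "xs j [^] N = \<one>" if "j \<in> {1..k}" "j \<noteq> i" for j
    proof -
      have "card (P j) dvd ?m"
        using that by (intro dvd_prodI) auto
      also have "?m dvd N" using N0 by (simp add: cong_0_iff)
      finally obtain t where "N = card (P j) * t" by blast
      moreover have "xs j [^] card (P j) = \<one>"
        using that xs by (intro subgroup_pow_card_eq_one subgroup_factor) auto
      moreover have "xs j \<in> carrier G" using xs that(1) by (rule tuple_component)
      ultimately show ?thesis by (metis nat_pow_pow nat_pow_one)
    qed
    have xi: "xs i \<in> carrier G" using xs i by (rule tuple_component)
    have pow: "xs i [^] card (P i) = \<one>"
      using i xs by (intro subgroup_pow_card_eq_one subgroup_factor) auto
    have "xs i [^] N = xs i"
    \<comment> \<open>Writing \<open>N\<close> as 1 plus a multiple needs \<open>N\<close> positive.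
      The value 0 occurs only if \<open>P i\<close> has order 1, and then \<open>xs i\<close> is the
      identity.\<close>
    proof (cases "N = 0")
      case True
      then have "card (P i) = 1" using N1 cong_0_1_nat by auto
      then show ?thesis using True pow xi by simp
    next
      case False
      then obtain t where "N = t * card (P i) + 1"
        using N1 cong_le_nat[of 1 N "card (P i)"] by auto
      then have "xs i [^] N = (xs i [^] card (P i)) [^] t \<otimes> xs i"
        using xi by (simp add: nat_pow_pow mult.commute)
      then show ?thesis using pow xi by simp
    qed
    moreover have "list_mult (\<lambda>j. xs j [^] N) [1..<Suc k] = xs i [^] N"
      using i xi one by (intro list_mult_single) auto
    ultimately show ?thesis
      unfolding tuple_elt_pow[OF xs] by (simp only: tuple_elt_eq)
  qed
  then show thesis by (rule that)
qed

text \<open>The projecting exponent depends on \<open>i\<close> only, so equal elements have equal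
  \<open>N\<close>-th powers and hence equal entries.\<close>

lemma tuple_elt_inject:
  assumes "xs \<in> tuples" "ys \<in> tuples" "tuple_elt G k xs = tuple_elt G k ys" "i \<in> {1..k}"
  shows "xs i = ys i"
  using assms by (metis projection_is_power)

lemma inj_on_tuple_elt: "inj_on (tuple_elt G k) (Pi\<^sub>E {1..k} P)"
proof (rule inj_onI)
  fix xs ys
  assume "xs \<in> Pi\<^sub>E {1..k} P" "ys \<in> Pi\<^sub>E {1..k} P" "tuple_elt G k xs = tuple_elt G k ys"
  then show "xs = ys"
    using tuple_elt_inject[of xs ys] by (intro PiE_ext) (auto simp: PiE_def)
qed

text \<open>An injective image of a set with \<open>order G\<close> elements inside the finite
  carrier must be the whole carrier.\<close>

lemma tuple_elt_image: "tuple_elt G k ` Pi\<^sub>E {1..k} P = carrier G"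
proof (rule card_subset_eq[OF finite_carrier])
  show "tuple_elt G k ` Pi\<^sub>E {1..k} P \<subseteq> carrier G"
    using tuple_elt_closed by (auto simp: PiE_def)
  show "card (tuple_elt G k ` Pi\<^sub>E {1..k} P) = card (carrier G)"
    unfolding card_image[OF inj_on_tuple_elt] using order_eq by (simp add: card_PiE order_def)
qed

lemma obtain_tuple:
  assumes "x \<in> carrier G"
  obtains xs where "xs \<in> tuples" "x = tuple_elt G k xs"
  using assms tuple_elt_image by (auto simp: PiE_def)

text \<open>A power of the product acts on all entries with one exponent. Conversely the exponents
  may differ from entry to entry, but every \<open>xs i\<close> is itself a power of the product, so
  its span contains each \<open>ys i\<close> and their product.\<close>

lemma mem_generate_tuple_elt_iff:
  assumes xs: "xs \<in> tuples" and ys: "ys \<in> tuples"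
  shows "tuple_elt G k ys \<in> generate G {tuple_elt G k xs} \<longleftrightarrow>
    (\<forall>i\<in>{1..k}. ys i \<in> generate G {xs i})"
proof
  assume "tuple_elt G k ys \<in> generate G {tuple_elt G k xs}"
  then obtain n :: nat where "tuple_elt G k ys = tuple_elt G k (\<lambda>i. xs i [^] n)"
    using mem_generate_iff_nat_pow[OF finite_carrier tuple_elt_closed[OF xs]] tuple_elt_pow[OF xs]
    by auto
  moreover have "(\<lambda>i. xs i [^] n) \<in> tuples"
    using xs subgroup_int_pow_closed[OF subgroup_factor, of _ _ "int n"] by (auto simp: int_pow_int Pi_iff)
  ultimately have "ys i = xs i [^] n" if "i \<in> {1..k}" for i
    using tuple_elt_inject[OF ys] that by blast
  then show "\<forall>i\<in>{1..k}. ys i \<in> generate G {xs i}"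
    using mem_generate_iff_nat_pow[OF finite_carrier tuple_component[OF xs]] by auto
next
  assume *: "\<forall>i\<in>{1..k}. ys i \<in> generate G {xs i}"
  let ?x = "tuple_elt G k xs"
  have x: "?x \<in> carrier G" using xs by (rule tuple_elt_closed)
  have "ys i \<in> generate G {?x}" if i: "i \<in> {1..k}" for i
  proof -
    obtain N :: nat where "?x [^] N = xs i"
      using projection_is_power[OF i] xs by metis
    then have "xs i \<in> generate G {?x}"
      using mem_generate_iff_nat_pow[OF finite_carrier x] by metis
    then have "generate G {xs i} \<subseteq> generate G {?x}"
      using generate_singleton_subset_iff x tuple_component[OF xs i] by blast
    then show ?thesis using * i by blast
  qed
  then show "tuple_elt G k ys \<in> generate G {?x}"
    unfolding tuple_elt_eq[of ys] using x
    by (intro subgroup_list_mult_closed generate_is_subgroup) auto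
qed

lemma tuple_elt_eq_one_iff:
  assumes "xs \<in> tuples"
  shows "tuple_elt G k xs = \<one> \<longleftrightarrow> (\<forall>i\<in>{1..k}. xs i = \<one>)"
proof
  assume "tuple_elt G k xs = \<one>"
  then show "\<forall>i\<in>{1..k}. xs i = \<one>"
    using assms by (metis projection_is_power nat_pow_one)
next
  assume "\<forall>i\<in>{1..k}. xs i = \<one>"
  then have "tuple_elt G k xs = tuple_elt G k (\<lambda>i. \<one> [^] (0::nat))"
    by (intro tuple_elt_cong) auto
  also have "\<dots> = tuple_elt G k xs [^] (0::nat)"
    using tuple_elt_pow[OF assms, of 0] by simp
  finally show "tuple_elt G k xs = \<one>" by simp
qed

text \<open>The witnesses are the element supported at \<open>j\<close> with entry \<open>w\<close>, and \<open>x\<close> with its \<open>j\<close>-th entry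
  replaced by \<open>w\<close>; the former is no power of \<open>x\<close> because of \<open>j\<close>, and \<open>x\<close> is no power of it because
  of \<open>l\<close>.\<close>

lemma tuple_elt_in_vertsI:
  assumes xs: "xs \<in> tuples" and j: "j \<in> {1..k}" and l: "l \<in> {1..k}" "l \<noteq> j" "xs l \<noteq> \<one>"
    and w: "w \<in> P j" "xs j \<in> generate G {w}" "w \<notin> generate G {xs j}"
  shows "tuple_elt G k xs \<in> verts (difference_graph G)"
proof -
  define ys where "ys = (\<lambda>_. \<one>)(j := w)"
  define zs where "zs = xs(j := w)"
  have ys: "ys \<in> tuples"
    using w j subgroup.one_closed[OF subgroup_factor] by (auto simp: ys_def)
  have zs: "zs \<in> tuples"
    using w xs by (auto simp: zs_def)
  \<comment> \<open>The product of \<open>zs\<close> generates the common cyclic subgroup: at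
    \<open>j\<close> both entries lie in the span of \<open>w\<close>, elsewhere they equal that of
    \<open>zs\<close> or the identity.\<close>
  have "tuple_elt G k xs \<in> generate G {tuple_elt G k zs}"
    unfolding mem_generate_tuple_elt_iff[OF zs xs] using w by (auto simp: zs_def intro: generate.incl)
  moreover have "tuple_elt G k ys \<in> generate G {tuple_elt G k zs}"
    unfolding mem_generate_tuple_elt_iff[OF zs ys]
    by (auto simp: zs_def ys_def intro: generate.incl generate.one)
  moreover have "tuple_elt G k xs \<notin> generate G {tuple_elt G k ys}"
    unfolding mem_generate_tuple_elt_iff[OF ys xs] using l
    by (auto simp: ys_def generate_one intro!: bexI[of _ l])
  moreover have "tuple_elt G k ys \<notin> generate G {tuple_elt G k xs}"
    unfolding mem_generate_tuple_elt_iff[OF xs ys] using w j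
    by (auto simp: ys_def intro!: bexI[of _ j])
  ultimately show ?thesis
    using xs ys zs tuple_elt_closed by (subst mem_verts_difference_graph_iff) blast
qed

text \<open>If the product \<open>?x\<close> lies in the span of \<open>z\<close>, maximality in
  every entry puts \<open>z\<close> back into the span of \<open>?x\<close>. Every enhanced
  neighbour is then a power of \<open>?x\<close>, so its edge is removed.\<close>

lemma maximal_tuple_elt_notin_verts:
  assumes xs: "xs \<in> tuples"
    and max: "\<forall>i\<in>{1..k}. xs i \<in> max_cyclic_generators (G\<lparr>carrier := P i\<rparr>)"
  shows "tuple_elt G k xs \<notin> verts (difference_graph G)"
proof
  let ?x = "tuple_elt G k xs"
  assume "?x \<in> verts (difference_graph G)"
  then obtain y z where z: "z \<in> carrier G" "?x \<in> generate G {z}"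
    and y: "y \<in> generate G {z}" "y \<notin> generate G {?x}"
    by (auto simp: mem_verts_difference_graph_iff)
  obtain zs where zs: "zs \<in> tuples" "z = tuple_elt G k zs"
    using obtain_tuple z(1) by blast
  have "zs i \<in> generate G {xs i}" if i: "i \<in> {1..k}" for i
    using i z(2) max mem_generate_tuple_elt_iff[OF zs(1) xs] zs
      mem_max_cyclic_generators_subgroup_iff[OF subgroup_factor[OF i]] by blast
  then have "z \<in> generate G {?x}"
    using mem_generate_tuple_elt_iff[OF xs zs(1)] zs(2) by blast
  then have "generate G {z} \<subseteq> generate G {?x}"
    using generate_singleton_subset_iff z(1) tuple_elt_closed[OF xs] by blast
  with y show False by blast
qed

text \<open>The identity lies in every cyclic subgroup, so all its edges are power graph
  edges.\<close>

lemma one_notin_verts: "\<one> \<notin> verts (difference_graph G)"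
  by (auto simp: mem_verts_difference_graph_iff generate.one)

lemma tuple_elt_notin_verts_iff:
  assumes "k \<ge> 2" and nontrivial: "\<And>i. i \<in> {1..k} \<Longrightarrow> P i \<noteq> {\<one>}" and xs: "xs \<in> tuples"
  shows "tuple_elt G k xs \<notin> verts (difference_graph G) \<longleftrightarrow>
    (\<forall>i\<in>{1..k}. xs i \<in> max_cyclic_generators (G\<lparr>carrier := P i\<rparr>)) \<or> (\<forall>i\<in>{1..k}. xs i = \<one>)"
    (is "_ \<longleftrightarrow> ?max \<or> ?one")
proof
  assume "?max \<or> ?one"
  then show "tuple_elt G k xs \<notin> verts (difference_graph G)"
    using maximal_tuple_elt_notin_verts[OF xs] tuple_elt_eq_one_iff[OF xs] one_notin_verts by auto
next
  assume notin: "tuple_elt G k xs \<notin> verts (difference_graph G)"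
  show "?max \<or> ?one"
  proof (rule ccontr)
    assume "\<not> (?max \<or> ?one)"
    then obtain i l where i: "i \<in> {1..k}" "xs i \<notin> max_cyclic_generators (G\<lparr>carrier := P i\<rparr>)"
      and l: "l \<in> {1..k}" "xs l \<noteq> \<one>" by blast
    obtain w where w: "w \<in> P i" "xs i \<in> generate G {w}" "w \<notin> generate G {xs i}"
      using i xs mem_max_cyclic_generators_subgroup_iff[OF subgroup_factor[OF i(1)]] by blast
    show False
    \<comment> \<open>Enlarging entry \<open>i\<close> to \<open>w\<close> yields an edge only if
      another entry is nontrivial. Otherwise the tuple is supported at \<open>i\<close>, and a
      trivial entry \<open>j\<close> is enlarged instead, with \<open>i\<close> as the nontrivial
      one.\<close>
    proof (cases "\<exists>l'\<in>{1..k}. l' \<noteq> i \<and> xs l' \<noteq> \<one>")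
      case True
      then show False
        using notin tuple_elt_in_vertsI[OF xs i(1) _ _ _ w] by blast
    next
      case False
      then have "xs i \<noteq> \<one>" using l by metis
      obtain j where j: "j \<in> {1..k}" "j \<noteq> i"
      proof -
        have "(if i = 1 then 2 else 1) \<in> {1..k}" "(if i = 1 then 2 else 1) \<noteq> i"
          using \<open>k \<ge> 2\<close> by auto
        then show thesis by (rule that)
      qed
      then have "xs j = \<one>" using False by blast
      \<comment> \<open>Any such \<open>v\<close> properly enlarges the trivial entry at
        \<open>j\<close>.\<close>
      obtain v where "v \<in> P j" "v \<noteq> \<one>"
        using nontrivial[OF j(1)] subgroup.one_closed[OF subgroup_factor[OF j(1)]] by blast
      then show False
        using notin tuple_elt_in_vertsI[OF xs j(1) i(1) _ \<open>xs i \<noteq> \<one>\<close>, of v] j \<open>xs j = \<one>\<close>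
        by (auto simp: generate.one generate_one)
    qed
  qed
qed

text \<open>The non-vertices are the identity and the products of tuples of maximal cyclic
  generators; \<open>tuple_elt\<close> is injective, so the latter are counted by a product.\<close>

lemma card_verts_difference_graph:
  assumes "k \<ge> 2" and nontrivial: "\<And>i. i \<in> {1..k} \<Longrightarrow> P i \<noteq> {\<one>}"
  shows "int (card (verts (difference_graph G))) =
    int (order G) - ((\<Prod>i\<in>{1..k}. int (card (max_cyclic_generators (G\<lparr>carrier := P i\<rparr>)))) + 1)"
proof -
  define M where "M i = max_cyclic_generators (G\<lparr>carrier := P i\<rparr>)" for i
  have M_subset: "M i \<subseteq> P i" for i
    by (auto simp: M_def max_cyclic_generators_def)
  \<comment> \<open>In a nontrivial factor the trivial subgroup is not maximal cyclic. Hence the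
    identity is not among the maximal tuples and contributes the separate summand 1.\<close>
  have one_notin: "\<one> \<notin> M i" if "i \<in> {1..k}" for i
    using nontrivial[OF that] subgroup.one_closed[OF subgroup_factor[OF that]]
    by (auto simp: M_def mem_max_cyclic_generators_subgroup_iff[OF subgroup_factor[OF that]]
        generate_one generate.one)
  let ?A = "tuple_elt G k ` Pi\<^sub>E {1..k} M"
  have tuples: "Pi\<^sub>E {1..k} M \<subseteq> Pi\<^sub>E {1..k} P"
    using M_subset by (intro PiE_mono) auto
  have "inj_on (tuple_elt G k) (Pi\<^sub>E {1..k} M)"
    using inj_on_subset[OF inj_on_tuple_elt tuples] .
  then have card_A: "card ?A = (\<Prod>i\<in>{1..k}. card (M i))"
    by (simp add: card_image card_PiE)
  have A_subset: "?A \<subseteq> carrier G"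
    using tuples tuple_elt_image by blast
  have "\<one> \<notin> ?A"
  proof
    assume "\<one> \<in> ?A"
    then obtain xs where xs: "xs \<in> Pi\<^sub>E {1..k} M" "tuple_elt G k xs = \<one>" by auto
    then have "xs 1 = \<one>"
      using tuple_elt_eq_one_iff[of xs] tuples \<open>k \<ge> 2\<close> by (auto simp: PiE_def)
    then show False
      using xs(1) one_notin[of 1] \<open>k \<ge> 2\<close> by (auto simp: PiE_def Pi_def)
  qed
  moreover have "verts (difference_graph G) = carrier G - insert \<one> ?A"
  proof -
    have "x \<notin> verts (difference_graph G) \<longleftrightarrow> x \<in> insert \<one> ?A" if x: "x \<in> carrier G" for x
    proof -
      obtain xs where xs: "xs \<in> Pi\<^sub>E {1..k} P" "x = tuple_elt G k xs"
        using x tuple_elt_image by blast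
      then have xs': "xs \<in> tuples" by (simp add: PiE_def)
      \<comment> \<open>Injectivity on all of \<open>Pi\<^sub>E {1..k} P\<close> excludes that
        \<open>x\<close> also arises from a different tuple with entries in
        \<open>M\<close>.\<close>
      have "x \<in> ?A \<longleftrightarrow> xs \<in> Pi\<^sub>E {1..k} M"
        using inj_on_image_mem_iff[OF inj_on_tuple_elt xs(1) tuples] by (simp add: xs(2))
      also have "\<dots> \<longleftrightarrow> (\<forall>i\<in>{1..k}. xs i \<in> M i)"
        using xs(1) by (auto simp: PiE_def Pi_def)
      finally show ?thesis
        using tuple_elt_notin_verts_iff[OF assms xs'] tuple_elt_eq_one_iff[OF xs']
        by (auto simp: M_def xs(2))
    qed
    moreover have "verts (difference_graph G) \<subseteq> carrier G"
      by (auto simp: mem_verts_difference_graph_iff)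
    ultimately show ?thesis by blast
  qed
  moreover have "finite ?A"
    using A_subset finite_carrier finite_subset by blast
  \<comment> \<open>The second inequality ensures that the natural subtraction is not truncated when
    passing to integers.\<close>
  ultimately have "card (verts (difference_graph G)) = order G - (card ?A + 1)"
    and "card ?A + 1 \<le> order G"
    using A_subset finite_carrier card_mono[OF finite_carrier, of "insert \<one> ?A"]
    by (auto simp: card_Diff_subset order_def)
  then show ?thesis
    using card_A by (simp add: M_def of_nat_diff)
qed

end

section \<open>Sylow subgroups of a nilpotent group as coprime factors\<close>

lemma nilpotent_sylow_coprime_product:
  fixes G :: "('a, 'b) monoid_scheme" (structure)
  assumes nilpotent: "nilpotent_group G" and finite: "finite (carrier G)"
    and inj: "inj_on p {1..k}" and primes: "p ` {1..k} = prime_factors (order G)"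
    and sylow: "\<forall>i\<in>{1..k}. sylow_subgroup G (p i) (P i)"
  shows "coprime_product G k P"
proof -
  interpret group G using nilpotent by (simp add: nilpotent_group_def)
  have sub: "subgroup (P i) G" and card: "card (P i) = p i ^ multiplicity (p i) (order G)"
    and prime: "Factorial_Ring.prime (p i)" if "i \<in> {1..k}" for i
    using that sylow primes by (auto simp: sylow_subgroup_def)
  have coprime: "coprime (card (P i)) (card (P j))" if "i \<in> {1..k}" "j \<in> {1..k}" "i \<noteq> j" for i j
  proof -
    have "p i \<noteq> p j" using inj that by (auto dest: inj_onD)
    then have "coprime (p i) (p j)" using prime that by (intro primes_coprime)
    then show ?thesis using that by (simp add: card)
  qed
  show ?thesis
  proof (intro coprime_product.intro coprime_product_axioms.intro)
    fix i j a b
    assume ij: "i \<in> {1..k}" "j \<in> {1..k}" "i \<noteq> j" and ab: "a \<in> P i" "b \<in> P j"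
    \<comment> \<open>The coprime exponents annihilating \<open>a\<close> and \<open>b\<close> are
      the orders of their Sylow subgroups, by Lagrange.\<close>
    show "a \<otimes> b = b \<otimes> a"
      using ab ij sub[THEN subgroup.mem_carrier] sub[THEN subgroup_pow_card_eq_one] coprime[OF ij]
      by (intro nilpotent_coprime_commute[OF nilpotent]) auto
  next
    \<comment> \<open>This is the prime factorization of the group order, reindexed along the
      injective \<open>p\<close>.\<close>
    have "order G = (\<Prod>q\<in>p ` {1..k}. q ^ multiplicity q (order G))"
      unfolding primes using finite by (intro prime_factorization_nat) (simp add: order_gt_0_iff_finite)
    also have "\<dots> = (\<Prod>i\<in>{1..k}. card (P i))"
      unfolding prod.reindex[OF inj] using card by simp
    finally show "order G = (\<Prod>i\<in>{1..k}. card (P i))" .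
  qed (use finite sub coprime in \<open>simp_all add: is_group\<close>)
qed

text \<open>The case of one prime is excluded by \<open>k \<ge> 2\<close>: in a p-group the
  difference graph has no vertices, and in the cyclic group of order 4 the element of order 2 is
  neither the identity nor a maximal cyclic generator.\<close>

theorem proposition2p2:
  fixes G :: "('a, 'b) monoid_scheme" (structure)
    and k :: nat and p :: "nat \<Rightarrow> nat" and P :: "nat \<Rightarrow> 'a set"
  assumes "nilpotent_group G" and "finite (carrier G)"
    and "k \<ge> 2"
    and "inj_on p {1..k}" and "p ` {1..k} = prime_factors (order G)"
    and "\<forall>i\<in>{1..k}. sylow_subgroup G (p i) (P i)"
  shows "(\<forall>x\<in>carrier G. \<forall>xs. (\<forall>i\<in>{1..k}. xs i \<in> P i) \<and> x = tuple_elt G k xs \<longrightarrow>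
            (x \<notin> verts (difference_graph G) \<longleftrightarrow>
              (\<forall>i\<in>{1..k}. xs i \<in> max_cyclic_generators (G\<lparr>carrier := P i\<rparr>)) \<or>
              (\<forall>i\<in>{1..k}. xs i = \<one>)))
       \<and> int (card (verts (difference_graph G))) =
            int (order G) -
              ((\<Prod>i\<in>{1..k}. int (card (max_cyclic_generators (G\<lparr>carrier := P i\<rparr>)))) + 1)"
proof -
  interpret coprime_product G k P
    using assms by (intro nilpotent_sylow_coprime_product)
  \<comment> \<open>Each \<open>p i\<close> divides the group order, so the order of its Sylow
    subgroup is a positive power of a prime.\<close>
  have nontrivial: "P i \<noteq> {\<one>}" if i: "i \<in> {1..k}" for i
  proof
    assume "P i = {\<one>}"
    moreover have "p i \<in> prime_factors (order G)" using assms(5) i by blast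
    then have "Factorial_Ring.prime (p i)" "multiplicity (p i) (order G) > 0"
      by (auto simp: prime_factors_multiplicity)
    then have "p i ^ multiplicity (p i) (order G) > 1"
      by (intro one_less_power prime_gt_1_nat)
    moreover have "card (P i) = p i ^ multiplicity (p i) (order G)"
      using assms(6) i by (simp add: sylow_subgroup_def)
    ultimately show False by simp
  qed
  show ?thesis
  proof (intro conjI ballI allI impI)
    fix x xs
    assume "(\<forall>i\<in>{1..k}. xs i \<in> P i) \<and> x = tuple_elt G k xs"
    then show "x \<notin> verts (difference_graph G) \<longleftrightarrow>
        (\<forall>i\<in>{1..k}. xs i \<in> max_cyclic_generators (G\<lparr>carrier := P i\<rparr>)) \<or> (\<forall>i\<in>{1..k}. xs i = \<one>)"
      using tuple_elt_notin_verts_iff[OF assms(3) nontrivial, of xs] by blast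
  qed (rule card_verts_difference_graph[OF assms(3) nontrivial])
qed

end
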